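(* There exists a positive constant $A$ such that for every natural number of the form $n=q_1q_2\cdots q_m$, where $m\ge 1$ and $q_1<q_2<\cdots<q_m$ are primes, if $n\ge A$ then $$e^{\gamma}n\log\log n-\sigma(n)>0.$$
   Context: $\sigma(n)=\sum_{d\mid n}d$ is the sum-of-divisors function, $\gamma$ is Euler's constant, and $\log$ is the natural logarithm. *)

theory Defs
  imports "HOL-Analysis.Analysis" "HOL-Computational_Algebra.Primes"
begin

(* Meaningful for n > 0 only: the divisors of 0 form an infinite set, so divisor_sigma 0 = 0. *)
definition divisor_sigma :: "nat \<Rightarrow> nat" where
  "divisor_sigma n = (\<Sum>d | d dvd n. d)"

end

theory Submission
  imports Defs
begin

text \<open>
  Let \<open>n\<close> be squarefree. Then \<open>\<sigma>(n)/n\<close> is the product of \<open>1 + 1/p\<close> over the primes \<open>p\<close> dividing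
  \<open>n\<close>. By Mertens' theorem the product of \<open>1 + 1/p\<close> over all \<open>p \<le> x\<close> is asymptotic to
  \<open>(6/\<pi>\<^sup>2) e\<^sup>\<gamma> ln x\<close>. With \<open>x = ln n\<close> this is below the claimed \<open>e\<^sup>\<gamma> ln ln n\<close> by the constant
  factor \<open>6/\<pi>\<^sup>2 < 0.61\<close>. Because of this slack the sharp constant in Mertens' theorem can be
  replaced by a cruder one, obtained as follows.

  Put \<open>\<epsilon> = 1/ln x\<close> and \<open>s = 1 + \<epsilon>\<close>. Replacing \<open>1/p\<close> by \<open>p\<^sup>-\<^sup>s\<close> for all \<open>p \<le> x\<close> costs at most a
  factor \<open>exp (\<epsilon> \<Sum> ln p / p)\<close>, which is \<open>e\<^bsup>1 + o(1)\<^esup>\<close> by the bound \<open>\<Sum> ln p / p \<le> ln x + ln 4\<close>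
  (\<open>sum_ln_prime_over_prime_le\<close>). The product of \<open>1 + p\<^sup>-\<^sup>s\<close> is a sum over squarefree numbers;
  multiplied by the sum of \<open>(k\<^sup>2)\<^sup>-\<^sup>s\<close> over \<open>k \<le> K\<close> it is part of \<open>\<zeta>(s)\<close>, hence at most
  \<open>1 + 1/\<epsilon> = 1 + ln x\<close> (\<open>euler_product_times_squares_le\<close>). Altogether the product of \<open>1 + 1/p\<close>
  over \<open>p \<le> x\<close> is at most \<open>(1 + o(1)) e ln x / \<Sum>k\<le>K. k\<^sup>-\<^sup>2\<close>. For \<open>K = 10\<close> the sum of
  inverse squares exceeds \<open>1.549\<close>, and \<open>e / 1.549 < 1.76 < e\<^sup>\<gamma>\<close>.

  The primes \<open>p > x\<close> dividing \<open>n\<close> contribute little: there are at most \<open>ln n / ln x = x / ln x\<close> of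
  them, so they contribute a factor of at most \<open>exp (1 / ln x)\<close>
  (\<open>prod_one_plus_inverse_large_le\<close>).
\<close>

section \<open>Products of primes\<close>

lemma prod_primes_dvd:
  fixes P :: "nat set"
  assumes "finite P" "\<And>p. p \<in> P \<Longrightarrow> prime p" "\<And>p. p \<in> P \<Longrightarrow> p dvd n"
  shows "\<Prod>P dvd n"
  using assms
proof (induction P rule: finite_induct)
  case (insert p P)
  have "coprime p (\<Prod>P)"
    by (rule prod_coprime_right) (metis insert.hyps(2) insert.prems(1) insertCI primes_coprime)
  then show ?case
    using insert by (simp add: divides_mult)
qed simp

lemma multiplicity_prod_primes:
  fixes P :: "nat set"
  assumes "finite P" "\<And>p. p \<in> P \<Longrightarrow> prime p" "prime r"
  shows "multiplicity r (\<Prod>P) = (if r \<in> P then 1 else 0)"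
proof -
  have "multiplicity r (\<Prod>P) = (if r \<in> P then (\<lambda>_. 1) r else 0)"
    using multiplicity_prod_prime_powers[OF assms, of "\<lambda>_. 1"] by simp
  then show ?thesis by simp
qed

text \<open>
  The decomposition of a number into a squarefree part and a square is unique, since a prime lies
  in \<open>X\<close> exactly if its multiplicity in \<open>\<Prod>X * k\<^sup>2\<close> is odd.
\<close>
lemma prime_part_times_square_inj:
  fixes P :: "nat set"
  assumes "finite P" "\<And>p. p \<in> P \<Longrightarrow> prime p"
  shows "inj_on (\<lambda>(X, k). \<Prod>X * k\<^sup>2) (Pow P \<times> {0<..})"
proof (rule inj_onI, clarify)
  fix X k Y l
  assume X: "X \<subseteq> P" and Y: "Y \<subseteq> P" and k: "k > 0" and l: "l > 0"
    and eq: "\<Prod>X * k\<^sup>2 = \<Prod>Y * l\<^sup>2"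
  have mult: "multiplicity r (\<Prod>Z * j\<^sup>2) = (if r \<in> Z then 1 else 0) + 2 * multiplicity r j"
    if Z: "Z \<subseteq> P" and r: "r \<in> P" and j: "j > 0" for r j :: nat and Z
  proof -
    have Z': "finite Z" "\<And>p. p \<in> Z \<Longrightarrow> prime p"
      using Z assms finite_subset by auto
    then have "\<Prod>Z \<noteq> 0" by (metis not_prime_0 prod_zero_iff)
    then show ?thesis
      using assms(2)[OF r] j multiplicity_prod_primes[OF Z' assms(2)[OF r]]
      by (simp add: prime_elem_multiplicity_mult_distrib prime_elem_multiplicity_power_distrib)
  qed
  have "r \<in> X \<longleftrightarrow> r \<in> Y" if r: "r \<in> P" for r
    using mult[OF X r k] mult[OF Y r l] eq by (auto split: if_splits) presburger+
  then have XY: "X = Y" using X Y by blast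
  have "\<Prod>Y \<noteq> 0"
    using Y assms by (metis finite_subset not_prime_0 prod_zero_iff subset_iff)
  then have "k\<^sup>2 = l\<^sup>2" using eq XY by simp
  then show "X = Y \<and> k = l" using XY by simp
qed

section \<open>Upper bounds of Chebyshev and Mertens\<close>

text \<open>
  Chebyshev's bound, by Erdos' induction: the primes in \<open>{m+2..2m+1}\<close> all divide the binomial
  coefficient \<open>2m+1 choose m\<close>, which is at most \<open>4\<^sup>m\<close>, and those up to \<open>m+1\<close> are covered by the
  induction hypothesis.
\<close>
lemma primorial_le_4_power: "\<Prod>{p. prime p \<and> p \<le> n} \<le> (4::nat) ^ n"
proof (induction n rule: less_induct)
  case (less n)
  consider "n \<le> 1" | "n = 2" | "n > 2" "even n" | "n > 2" "odd n" by linarith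
  then show ?case
  proof cases
    case 1
    then have none: "{p. prime p \<and> p \<le> n} = {}" by (auto dest: prime_ge_2_nat)
    show ?thesis unfolding none by simp
  next
    case 2
    then have two: "{p::nat. prime p \<and> p \<le> n} = {2}" by (auto dest: prime_ge_2_nat intro: antisym)
    show ?thesis unfolding two using 2 by simp
  next
    case 3
    then have "\<not> prime n" using prime_odd_nat by blast
    then have "{p. prime p \<and> p \<le> n} = {p. prime p \<and> p \<le> n - 1}"
      using 3 by (auto simp: le_less)
    then have "\<Prod>{p. prime p \<and> p \<le> n} \<le> 4 ^ (n - 1)"
      using less[of "n - 1"] 3 by simp
    also have "\<dots> \<le> (4::nat) ^ n" by (intro power_increasing) auto
    finally show ?thesis .
  next
    case 4
    then obtain m where m: "n = 2 * m + 1" "m \<ge> 1" by (auto elim!: oddE)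
    let ?H = "{p. prime p \<and> m + 1 < p \<and> p \<le> 2 * m + 1}"
    have fin: "finite ?H" by (rule finite_subset[of _ "{..2*m+1}"]) auto
    have "p dvd (2 * m + 1 choose m)" if p: "p \<in> ?H" for p
    proof -
      have "fact m * fact (m + 1) * (2 * m + 1 choose m) = (fact (2 * m + 1) :: nat)"
        using binomial_fact_lemma[of m "2 * m + 1"] by simp
      moreover have "p dvd fact (2 * m + 1)" "\<not> p dvd fact m" "\<not> p dvd fact (m + 1)"
        using p by (subst prime_dvd_fact_iff; auto)+
      ultimately show ?thesis
        using p by (metis (no_types, lifting) mem_Collect_eq prime_dvd_mult_iff)
    qed
    then have "\<Prod>?H dvd (2 * m + 1 choose m)"
      by (intro prod_primes_dvd fin) auto
    then have "\<Prod>?H \<le> (2 * m + 1 choose m)" by (rule dvd_imp_le) simp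
    also have "\<dots> \<le> (\<Sum>k\<le>m. 2 * m + 1 choose k)"
      by (rule member_le_sum) auto
    also have "\<dots> = 4 ^ m" unfolding binomial_r_part_sum by (simp add: power_mult)
    finally have H: "\<Prod>?H \<le> 4 ^ m" .
    have "{p. prime p \<and> p \<le> n} = {p. prime p \<and> p \<le> m + 1} \<union> ?H"
      using m by auto
    moreover have "\<Prod>({p. prime p \<and> p \<le> m + 1} \<union> ?H) = \<Prod>{p. prime p \<and> p \<le> m + 1} * \<Prod>?H"
      by (rule prod.union_disjoint) (use fin in auto)
    ultimately have "\<Prod>{p. prime p \<and> p \<le> n} = \<Prod>{p. prime p \<and> p \<le> m + 1} * \<Prod>?H" by simp
    also have "\<dots> \<le> 4 ^ (m + 1) * 4 ^ m"
      by (intro mult_mono H less) (use m in auto)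
    also have "\<dots> = 4 ^ n" using m by (simp add: mult_2 power_add)
    finally show ?thesis .
  qed
qed

lemma ln_of_nat_mono: "0 < a \<Longrightarrow> a \<le> b \<Longrightarrow> ln (real a) \<le> ln (real b)"
  by simp

text \<open>
  A weak form of Legendre's formula that ignores higher prime powers. When \<open>n\<close> grows to \<open>n+1\<close>,
  the left side grows by the sum of \<open>ln p\<close> over the \<open>p \<in> P\<close> dividing \<open>n+1\<close>, and the product of
  these primes divides \<open>n+1\<close>.
\<close>
lemma sum_ln_times_div_le_ln_fact:
  fixes P :: "nat set"
  assumes "finite P" "\<And>p. p \<in> P \<Longrightarrow> prime p"
  shows "(\<Sum>p\<in>P. real (n div p) * ln (real p)) \<le> ln (fact n)"
proof (induction n)
  case (Suc n)
  let ?D = "{p \<in> P. p dvd Suc n}"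
  have "(\<Sum>p\<in>P. real (Suc n div p) * ln (real p))
      = (\<Sum>p\<in>P. real (n div p) * ln (real p)) + (\<Sum>p\<in>P. if p dvd Suc n then ln (real p) else 0)"
    unfolding sum.distrib[symmetric]
    by (rule sum.cong) (auto simp: div_Suc dvd_eq_mod_eq_0 algebra_simps)
  also have "(\<Sum>p\<in>P. if p dvd Suc n then ln (real p) else 0) = (\<Sum>p\<in>?D. ln (real p))"
    using assms(1) by (simp add: sum.inter_filter)
  also have "\<dots> = ln (\<Prod>p\<in>?D. real p)"
    using assms by (subst ln_prod) (auto simp: prime_gt_0_nat)
  also have "\<dots> = ln (real (\<Prod>?D))" by simp
  also have "\<dots> \<le> ln (real (Suc n))"
  proof -
    have "\<Prod>?D dvd Suc n" using assms by (intro prod_primes_dvd) auto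
    then have "\<Prod>?D \<le> Suc n" "\<Prod>?D > 0" by (auto intro: dvd_imp_le dvd_pos_nat)
    then show ?thesis by (intro ln_of_nat_mono)
  qed
  also have "(\<Sum>p\<in>P. real (n div p) * ln (real p)) \<le> ln (fact n)" by (rule Suc.IH)
  finally show ?case by (simp add: ln_mult add.commute)
qed simp

text \<open>
  The upper half of Mertens' first theorem. Up to an error of \<open>\<Sum> ln p \<le> n ln 4\<close> from rounding,
  \<open>n \<Sum> ln p / p\<close> is the sum of the preceding lemma, hence at most \<open>ln n! \<le> n ln n\<close>.
\<close>
lemma sum_ln_prime_over_prime_le:
  assumes "n \<ge> 1"
  shows "(\<Sum>p | prime p \<and> p \<le> n. ln (real p) / real p) \<le> ln (real n) + ln 4"
proof -
  let ?P = "{p. prime p \<and> p \<le> n}"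
  have fin: "finite ?P" by simp
  have "real n * (\<Sum>p\<in>?P. ln (real p) / real p)
      = (\<Sum>p\<in>?P. (real n / real p - 1) * ln (real p)) + (\<Sum>p\<in>?P. ln (real p))"
    unfolding sum.distrib[symmetric] sum_distrib_left
    by (rule sum.cong) (auto simp: field_simps)
  also have "(\<Sum>p\<in>?P. (real n / real p - 1) * ln (real p)) \<le> (\<Sum>p\<in>?P. real (n div p) * ln (real p))"
  proof (intro sum_mono mult_right_mono)
    fix p assume "p \<in> ?P"
    then have p: "prime p" by simp
    show "real n / real p - 1 \<le> real (n div p)"
      using real_of_int_div3[of "int n" "int p"] by (simp flip: zdiv_int)
    show "ln (real p) \<ge> 0" using prime_gt_0_nat[OF p] by simp
  qed
  also have "\<dots> \<le> ln (fact n)" by (rule sum_ln_times_div_le_ln_fact) auto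
  also have "\<dots> \<le> ln (real n ^ n)"
  proof -
    have "(fact n :: real) \<le> real n ^ n"
      using fact_le_power[of n, where 'a = real] by simp
    then show ?thesis by (intro ln_mono) auto
  qed
  also have "\<dots> = real n * ln (real n)" using assms by (simp add: ln_realpow)
  also have "(\<Sum>p\<in>?P. ln (real p)) = ln (real (\<Prod>?P))"
    unfolding of_nat_prod by (subst ln_prod) (auto simp: prime_gt_0_nat)
  also have "\<dots> \<le> ln (4 ^ n)"
  proof -
    have "\<Prod>?P \<le> 4 ^ n" by (rule primorial_le_4_power)
    moreover have "\<Prod>?P > 0" by (intro prod_pos) (auto simp: prime_gt_0_nat)
    ultimately show ?thesis using ln_of_nat_mono[of "\<Prod>?P" "4 ^ n"] by simp
  qed
  also have "\<dots> = real n * ln 4" by (simp add: ln_realpow)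
  finally have "real n * (\<Sum>p\<in>?P. ln (real p) / real p) \<le> real n * (ln (real n) + ln 4)"
    by (simp add: algebra_simps)
  then show ?thesis using assms by simp
qed

section \<open>Euler products\<close>

text \<open>
  The bound \<open>\<zeta>(1 + \<epsilon>) \<le> 1 + 1/\<epsilon>\<close>. The induction carries the stronger bound obtained by comparing
  the sum with the integral of \<open>t\<^bsup>-1-\<epsilon>\<^esup>\<close> over \<open>[1, N]\<close>.
\<close>
lemma sum_powr_le_one_plus_inverse:
  assumes "\<epsilon> > 0"
  shows "(\<Sum>n = 1..N. real n powr (-(1 + \<epsilon>))) \<le> 1 + 1 / \<epsilon>"
proof (cases "N \<ge> 1")
  case True
  have "(\<Sum>n = 1..N. real n powr (-(1 + \<epsilon>))) \<le> 1 + (1 - real N powr (-\<epsilon>)) / \<epsilon>"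
    using True
  proof (induction N rule: dec_induct)
    case (step N)
    let ?b = "1 + real N"
    have N: "real N > 0" using step by simp
    have "ln (real N / ?b) \<le> real N / ?b - 1"
      using N by (intro ln_le_minus_one) auto
    also have "\<dots> = - (1 / ?b)" using N by (simp add: field_simps)
    finally have "\<epsilon> / ?b \<le> - \<epsilon> * ln (real N / ?b)"
      using mult_left_mono[of _ _ \<epsilon>] assms by fastforce
    then have "1 + \<epsilon> / ?b \<le> exp (- \<epsilon> * ln (real N / ?b))"
      using exp_ge_add_one_self order_trans by (metis add_left_mono)
    also have "\<dots> = (real N / ?b) powr (-\<epsilon>)" using N by (simp add: powr_def)
    also have "\<dots> = real N powr (-\<epsilon>) / ?b powr (-\<epsilon>)" using N by (simp add: powr_divide)
    finally have "?b powr (-\<epsilon>) * (1 + \<epsilon> / ?b) \<le> real N powr (-\<epsilon>)"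
      using N by (simp add: field_simps)
    moreover have "?b powr (-(1 + \<epsilon>)) = ?b powr (-\<epsilon>) / ?b"
    proof -
      have "-(1 + \<epsilon>) = -\<epsilon> - 1" by simp
      then have "?b powr (-(1 + \<epsilon>)) = ?b powr (-\<epsilon> - 1)" by (simp only:)
      then show ?thesis using powr_diff[of ?b "-\<epsilon>" 1] N by simp
    qed
    ultimately have "?b powr (-(1 + \<epsilon>)) * \<epsilon> \<le> real N powr (-\<epsilon>) - ?b powr (-\<epsilon>)"
      by (simp add: algebra_simps)
    then have "?b powr (-(1 + \<epsilon>)) \<le> (real N powr (-\<epsilon>) - ?b powr (-\<epsilon>)) / \<epsilon>"
      using assms by (simp add: pos_le_divide_eq)
    then show ?case
      using step.IH by (simp add: diff_divide_distrib add.commute)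
  qed (use assms in auto)
  also have "\<dots> \<le> 1 + 1 / \<epsilon>" using assms by (simp add: divide_right_mono)
  finally show ?thesis .
qed (use assms in auto)

text \<open>
  A truncated form of \<open>\<Prod>(1 + p\<^sup>-\<^sup>s) = \<zeta>(s) / \<zeta>(2s)\<close>. Expanding the product on the left gives a
  sum of terms \<open>n\<^sup>-\<^sup>s\<close> over pairwise distinct \<open>n\<close>, by \<open>prime_part_times_square_inj\<close>.
\<close>
lemma euler_product_times_squares_le:
  fixes P :: "nat set"
  assumes "finite P" "\<And>p. p \<in> P \<Longrightarrow> prime p" "\<epsilon> > 0"
  shows "(\<Prod>p\<in>P. 1 + real p powr (-(1 + \<epsilon>))) * (\<Sum>k = 1..K. real (k\<^sup>2) powr (-(1 + \<epsilon>)))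
    \<le> 1 + 1 / \<epsilon>"
proof -
  define f where "f = (\<lambda>n::nat. real n powr (-(1 + \<epsilon>)))"
  define g where "g = (\<lambda>(X::nat set, k::nat). \<Prod>X * k\<^sup>2)"
  define A where "A = Pow P \<times> {1..K}"
  have f_mult: "f (a * b) = f a * f b" for a b
    by (simp add: f_def powr_mult)
  have f_prod: "f (\<Prod>X) = (\<Prod>p\<in>X. f p)" for X
    by (simp add: f_def prod_powr_distrib)
  have finA: "finite A" using assms by (simp add: A_def)
  have inj: "inj_on g A"
    unfolding g_def A_def
    by (rule inj_on_subset[OF prime_part_times_square_inj[OF assms(1,2)]]) auto
  have "(\<Prod>p\<in>P. 1 + f p) * (\<Sum>k = 1..K. f (k\<^sup>2)) = (\<Sum>X\<in>Pow P. f (\<Prod>X)) * (\<Sum>k = 1..K. f (k\<^sup>2))"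
    using prod_add[OF assms(1), of f "\<lambda>_. 1"] by (simp add: f_prod add.commute)
  also have "\<dots> = (\<Sum>a\<in>A. f (g a))"
    unfolding sum_product sum.cartesian_product A_def
    by (rule sum.cong) (auto simp: g_def f_mult)
  also have "\<dots> = (\<Sum>n\<in>g ` A. f n)" using inj by (simp add: sum.reindex)
  also have "\<dots> \<le> (\<Sum>n = 1..Max (g ` A). f n)"
  proof (rule sum_mono2)
    show "g ` A \<subseteq> {1..Max (g ` A)}"
    proof
      fix n assume n: "n \<in> g ` A"
      then obtain X k where "X \<subseteq> P" "k \<ge> 1" "n = \<Prod>X * k\<^sup>2"
        by (auto simp: g_def A_def)
      then have "n \<ge> 1"
        using assms(2) prime_gt_0_nat prod_pos[of X "\<lambda>p. p"]
        by (simp add: Suc_le_eq subset_iff)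
      then show "n \<in> {1..Max (g ` A)}" using n finA by auto
    qed
  qed (auto simp: f_def)
  also have "\<dots> \<le> 1 + 1 / \<epsilon>"
    unfolding f_def by (rule sum_powr_le_one_plus_inverse) fact
  finally show ?thesis by (simp add: f_def)
qed

text \<open>
  Each factor satisfies \<open>1 + 1/p \<le> (1 + p\<^bsup>-1-\<epsilon>\<^esup>) exp (\<epsilon> ln p / p)\<close>, because
  \<open>1/p - p\<^bsup>-1-\<epsilon>\<^esup> = (1 - exp (- \<epsilon> ln p)) / p \<le> \<epsilon> ln p / p\<close>. For \<open>\<epsilon> = 1/ln n\<close>, which minimises
  \<open>exp (\<epsilon> ln n) / \<epsilon>\<close>, the right side grows like \<open>e ln n\<close>.
\<close>
lemma prod_one_plus_inverse_prime_le:
  assumes "\<epsilon> > 0" "n \<ge> 1"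
  shows "(\<Prod>p | prime p \<and> p \<le> n. 1 + 1 / real p) * (\<Sum>k = 1..K. real (k\<^sup>2) powr (-(1 + \<epsilon>)))
    \<le> (1 + 1 / \<epsilon>) * exp (\<epsilon> * (ln (real n) + ln 4))"
proof -
  let ?P = "{p. prime p \<and> p \<le> n}"
  let ?S = "\<Sum>k = 1..K. real (k\<^sup>2) powr (-(1 + \<epsilon>))"
  have "(\<Prod>p\<in>?P. 1 + 1 / real p)
      \<le> (\<Prod>p\<in>?P. (1 + real p powr (-(1 + \<epsilon>))) * exp (\<epsilon> * (ln (real p) / real p)))"
  proof (rule prod_mono, safe)
    fix p :: nat assume "prime p"
    then have p: "real p > 0" by (simp add: prime_gt_0_nat)
    let ?t = "\<epsilon> * ln (real p)"
    let ?a = "real p powr (-(1 + \<epsilon>))"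
    have a: "?a = exp (- ?t) / real p"
      using p by (simp add: powr_diff powr_def[of _ \<epsilon>] powr_minus exp_minus field_simps flip: powr_minus)
    have "1 - ?t \<le> exp (- ?t)" using exp_ge_add_one_self[of "- ?t"] by simp
    then have "1 / real p - ?t / real p \<le> ?a"
      using p unfolding a by (simp add: divide_right_mono flip: diff_divide_distrib)
    moreover have "0 \<le> ?a * (?t / real p)" 
      using p assms \<open>prime p\<close> prime_gt_0_nat by (intro mult_nonneg_nonneg divide_nonneg_pos) (auto simp: Suc_le_eq)
    ultimately have "1 + 1 / real p \<le> (1 + ?a) * (1 + ?t / real p)"
      by (simp add: algebra_simps)
    also have "\<dots> \<le> (1 + ?a) * exp (?t / real p)"
      by (intro mult_left_mono) (auto intro: exp_ge_add_one_self add_nonneg_nonneg)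
    finally show "1 + 1 / real p \<le> (1 + ?a) * exp (\<epsilon> * (ln (real p) / real p))" by simp
  qed auto
  also have "\<dots> = (\<Prod>p\<in>?P. 1 + real p powr (-(1 + \<epsilon>))) * exp (\<epsilon> * (\<Sum>p\<in>?P. ln (real p) / real p))"
    by (simp add: prod.distrib exp_sum sum_distrib_left)
  also have "\<dots> \<le> (\<Prod>p\<in>?P. 1 + real p powr (-(1 + \<epsilon>))) * exp (\<epsilon> * (ln (real n) + ln 4))"
    using assms sum_ln_prime_over_prime_le[of n]
    by (intro mult_left_mono prod_nonneg) (auto intro: add_nonneg_nonneg)
  finally have "(\<Prod>p\<in>?P. 1 + 1 / real p) * ?S
      \<le> ((\<Prod>p\<in>?P. 1 + real p powr (-(1 + \<epsilon>))) * exp (\<epsilon> * (ln (real n) + ln 4))) * ?S"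
    by (rule mult_right_mono) (auto intro: sum_nonneg)
  also have "\<dots> = ((\<Prod>p\<in>?P. 1 + real p powr (-(1 + \<epsilon>))) * ?S) * exp (\<epsilon> * (ln (real n) + ln 4))"
    by (simp only: mult_ac)
  also have "\<dots> \<le> (1 + 1 / \<epsilon>) * exp (\<epsilon> * (ln (real n) + ln 4))"
    by (intro mult_right_mono euler_product_times_squares_le assms) auto
  finally show ?thesis .
qed

section \<open>The divisor sum of a squarefree number\<close>

lemma divisor_sigma_prime_mult_le:
  assumes "prime p" "n > 0"
  shows "divisor_sigma (p * n) \<le> (1 + p) * divisor_sigma n"
proof -
  have fin: "finite {d. d dvd n}" using assms by simp
  have "{d. d dvd p * n} \<subseteq> {d. d dvd n} \<union> (*) p ` {d. d dvd n}"
  proof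
    fix d assume "d \<in> {d. d dvd p * n}"
    then obtain a b where d: "d = a * b" and a: "a dvd p" and b: "b dvd n"
      by (metis dvd_productE mem_Collect_eq)
    have "a = 1 \<or> a = p" using a assms(1) by (auto simp: prime_nat_iff)
    then show "d \<in> {d. d dvd n} \<union> (*) p ` {d. d dvd n}" using d b by auto
  qed
  then have "divisor_sigma (p * n) \<le> \<Sum>({d. d dvd n} \<union> (*) p ` {d. d dvd n})"
    unfolding divisor_sigma_def using fin by (intro sum_mono2) auto
  also have "\<dots> \<le> \<Sum>{d. d dvd n} + \<Sum>((*) p ` {d. d dvd n})"
    using fin by (simp add: sum_Un_nat)
  also have "\<Sum>((*) p ` {d. d dvd n}) = p * \<Sum>{d. d dvd n}"
    using assms(1) prime_gt_0_nat[of p] by (subst sum.reindex) (auto intro!: inj_onI simp: sum_distrib_left)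
  finally show ?thesis by (simp add: divisor_sigma_def)
qed

lemma divisor_sigma_prod_primes_le:
  assumes "finite P" "\<And>p. p \<in> P \<Longrightarrow> prime p"
  shows "real (divisor_sigma (\<Prod>P)) \<le> real (\<Prod>P) * (\<Prod>p\<in>P. 1 + 1 / real p)"
proof -
  have "divisor_sigma (\<Prod>P) \<le> (\<Prod>p\<in>P. 1 + p)"
    using assms
  proof (induction P rule: finite_induct)
    case (insert p P)
    have "divisor_sigma (p * \<Prod>P) \<le> (1 + p) * divisor_sigma (\<Prod>P)"
      using insert.prems by (intro divisor_sigma_prime_mult_le prod_pos) (auto simp: prime_gt_0_nat)
    also have "\<dots> \<le> (1 + p) * (\<Prod>p\<in>P. 1 + p)"
      using insert by (intro mult_left_mono) auto
    finally show ?case using insert.hyps by simp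
  qed (simp add: divisor_sigma_def)
  then have "real (divisor_sigma (\<Prod>P)) \<le> real (\<Prod>p\<in>P. 1 + p)" by (rule of_nat_mono)
  also have "\<dots> = (\<Prod>p\<in>P. real p * (1 + 1 / real p))"
    unfolding of_nat_prod using assms(2)
    by (intro prod.cong) (auto simp: field_simps prime_gt_0_nat)
  also have "\<dots> = real (\<Prod>P) * (\<Prod>p\<in>P. 1 + 1 / real p)"
    by (simp add: prod.distrib)
  finally show ?thesis .
qed

text \<open>
  The hypotheses give \<open>x ^ card P \<le> \<Prod>P \<le> exp x\<close>, so \<open>P\<close> has at most \<open>x / ln x\<close> elements, and each
  factor is at most \<open>exp (1/x)\<close>.
\<close>
lemma prod_one_plus_inverse_large_le:
  fixes P :: "nat set"
  assumes "finite P" "x > 1" "\<And>p. p \<in> P \<Longrightarrow> real p > x" "ln (real (\<Prod>P)) \<le> x"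
  shows "(\<Prod>p\<in>P. 1 + 1 / real p) \<le> exp (1 / ln x)"
proof -
  have "real (card P) * ln x = (\<Sum>p\<in>P. ln x)" by simp
  also have "\<dots> \<le> (\<Sum>p\<in>P. ln (real p))"
    using assms(2,3) by (intro sum_mono ln_mono) force+
  also have "\<dots> = ln (real (\<Prod>P))"
    unfolding of_nat_prod using assms(2,3) by (subst ln_prod[OF assms(1)]) force+
  also have "\<dots> \<le> x" by fact
  finally have card: "real (card P) / x \<le> 1 / ln x"
    using assms(2) by (simp add: field_simps)
  have "(\<Prod>p\<in>P. 1 + 1 / real p) \<le> (\<Prod>p\<in>P. exp (1 / x))"
  proof (rule prod_mono, safe)
    fix p assume p: "p \<in> P"
    have "1 + 1 / real p \<le> 1 + 1 / x"
      using assms(2) assms(3)[OF p] by (simp add: frac_le)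
    also have "\<dots> \<le> exp (1 / x)" by (rule exp_ge_add_one_self)
    finally show "1 + 1 / real p \<le> exp (1 / x)" .
  qed auto
  also have "\<dots> = exp (real (card P) / x)"
    by (simp add: exp_of_nat_mult[symmetric])
  also have "\<dots> \<le> exp (1 / ln x)" using card by simp
  finally show ?thesis .
qed

lemma prod_one_plus_inverse_prime_divisors_le:
  fixes P :: "nat set"
  assumes "finite P" "\<And>p. p \<in> P \<Longrightarrow> prime p" "x > 1" "ln (real (\<Prod>P)) \<le> x"
  shows "(\<Prod>p\<in>P. 1 + 1 / real p)
    \<le> (\<Prod>p | prime p \<and> p \<le> nat \<lfloor>x\<rfloor>. 1 + 1 / real p) * exp (1 / ln x)"
proof -
  let ?S = "{p \<in> P. real p \<le> x}" and ?L = "{p \<in> P. real p > x}"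
  have pos: "\<Prod>P > 0" using assms(2) by (intro prod_pos) (auto simp: prime_gt_0_nat)
  have "\<Prod>?L dvd \<Prod>P" by (rule prod_dvd_prod_subset) (use assms in auto)
  then have "\<Prod>?L \<le> \<Prod>P" "\<Prod>?L > 0" using pos by (auto intro: dvd_imp_le dvd_pos_nat)
  then have "ln (real (\<Prod>?L)) \<le> ln (real (\<Prod>P))"
    by (intro ln_of_nat_mono)
  then have large: "(\<Prod>p\<in>?L. 1 + 1 / real p) \<le> exp (1 / ln x)"
    using assms by (intro prod_one_plus_inverse_large_le) auto
  have small: "(\<Prod>p\<in>?S. 1 + 1 / real p) \<le> (\<Prod>p | prime p \<and> p \<le> nat \<lfloor>x\<rfloor>. 1 + 1 / real p)"
    using assms by (intro prod_mono2) (auto simp: le_nat_floor)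
  have "P = ?S \<union> ?L" by auto
  then have "(\<Prod>p\<in>P. 1 + 1 / real p) = (\<Prod>p\<in>?S \<union> ?L. 1 + 1 / real p)" by simp
  also have "\<dots> = (\<Prod>p\<in>?S. 1 + 1 / real p) * (\<Prod>p\<in>?L. 1 + 1 / real p)"
    using assms(1) by (intro prod.union_disjoint) auto
  also have "\<dots> \<le> (\<Prod>p | prime p \<and> p \<le> nat \<lfloor>x\<rfloor>. 1 + 1 / real p) * exp (1 / ln x)"
    using small large by (intro mult_mono prod_nonneg) auto
  finally show ?thesis .
qed

text \<open>
  The bounds above combined at \<open>x = ln n\<close> and \<open>\<epsilon> = 1/ln x\<close>, where \<open>n = \<Prod>P\<close>.
\<close>
lemma divisor_sigma_prod_primes_le_explicit:
  fixes P :: "nat set" and K :: nat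
  defines "L \<equiv> ln (ln (real (\<Prod>P)))"
  assumes "finite P" "\<And>p. p \<in> P \<Longrightarrow> prime p" "ln (real (\<Prod>P)) > 1"
  shows "real (divisor_sigma (\<Prod>P)) * (\<Sum>k = 1..K. real (k\<^sup>2) powr (-(1 + 1 / L)))
     \<le> real (\<Prod>P) * L * ((1 + 1 / L) * exp (1 + ln 4 / L + 1 / L))"
proof -
  define x where "x = ln (real (\<Prod>P))"
  let ?S = "\<Sum>k = 1..K. real (k\<^sup>2) powr (-(1 + 1 / L))"
  let ?Q = "\<Prod>p | prime p \<and> p \<le> nat \<lfloor>x\<rfloor>. 1 + 1 / real p"
  have x: "x > 1" "L = ln x" unfolding x_def L_def by (fact assms refl)+
  then have L: "L > 0" by simp
  have n: "real (\<Prod>P) \<ge> 0" by (rule of_nat_0_le_iff)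
  have S: "?S \<ge> 0" by (rule sum_nonneg) auto
  have floor: "real (nat \<lfloor>x\<rfloor>) \<le> x" "nat \<lfloor>x\<rfloor> \<ge> 1" using x by (auto simp: le_nat_floor)
  have "real (divisor_sigma (\<Prod>P)) * ?S \<le> (real (\<Prod>P) * (\<Prod>p\<in>P. 1 + 1 / real p)) * ?S"
    using assms(2,3) by (intro mult_right_mono[OF _ S] divisor_sigma_prod_primes_le)
  also have "\<dots> \<le> (real (\<Prod>P) * (?Q * exp (1 / L))) * ?S"
  proof -
    have "(\<Prod>p\<in>P. 1 + 1 / real p) \<le> ?Q * exp (1 / L)"
      unfolding x(2)
      by (rule prod_one_plus_inverse_prime_divisors_le[OF assms(2,3) x(1)]) (auto simp: x_def)
    then show ?thesis using n S by (intro mult_right_mono mult_left_mono)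
  qed
  also have "\<dots> = real (\<Prod>P) * exp (1 / L) * (?Q * ?S)" by (simp only: mult_ac)
  also have "\<dots> \<le> real (\<Prod>P) * exp (1 / L) * ((1 + 1 / (1 / L)) * exp (1 / L * (ln (real (nat \<lfloor>x\<rfloor>)) + ln 4)))"
    using L floor n by (intro mult_left_mono prod_one_plus_inverse_prime_le mult_nonneg_nonneg) auto
  also have "\<dots> \<le> real (\<Prod>P) * exp (1 / L) * ((1 + 1 / (1 / L)) * exp (1 / L * (L + ln 4)))"
  proof -
    have "ln (real (nat \<lfloor>x\<rfloor>)) \<le> L" unfolding x(2) using floor by (intro ln_mono) auto
    then show ?thesis using L n
      by (intro mult_left_mono mult_nonneg_nonneg iffD2[OF exp_le_cancel_iff]) auto
  qed
  also have "\<dots> = real (\<Prod>P) * L * ((1 + 1 / L) * exp (1 + ln 4 / L + 1 / L))"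
  proof -
    have "1 / L * (L + ln 4) = 1 + ln 4 / L" using L by (simp add: field_simps)
    moreover have "1 + 1 / (1 / L) = L * (1 + 1 / L)" using L by (simp add: field_simps)
    ultimately show ?thesis by (simp only: exp_add mult_ac)
  qed
  finally show ?thesis .
qed

section \<open>Comparison of the constants\<close>

text \<open>
  The numerical inequality that decides the theorem. Its left side is \<open>2.718\<dots>\<close> and its right
  side \<open>2.760\<dots>\<close>; ten squares leave room for the simple estimate of \<open>exp (-14/33)\<close> below, where
  \<open>14/33 = 1 - 19/33\<close> comes from the lower bound \<open>19/33\<close> for \<open>\<gamma>\<close>.
\<close>
lemma exp_one_less_exp_euler_mascheroni_mult: "exp 1 < exp euler_mascheroni * (\<Sum>k = 1..10. 1 / real (k\<^sup>2))"
proof -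
  \<comment> \<open>\<open>1 + t \<le> exp t\<close> is accurate enough only for small \<open>t\<close>, hence the tenth root.\<close>
  have "1 - 14/330 \<le> exp (- 14/330 :: real)" using exp_ge_add_one_self[of "- 14/330"] by simp
  then have "(1 - 14/330) ^ 10 \<le> exp (- 14/330 :: real) ^ 10" by (intro power_mono) auto
  also have "\<dots> = exp (- 14/33)" by (simp flip: exp_of_nat_mult)
  finally have *: "(1 - 14/330) ^ 10 \<le> exp (19/33 - 1 :: real)" by simp
  have "(1::real) < (1 - 14/330) ^ 10 * (\<Sum>k = 1..10. 1 / real (k\<^sup>2))"
    by (simp add: eval_nat_numeral)
  also have "\<dots> \<le> exp (euler_mascheroni - 1) * (\<Sum>k = 1..10. 1 / real (k\<^sup>2))"
    using * euler_mascheroni_gt_19_over_33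
    by (intro mult_right_mono sum_nonneg) (auto intro: order_trans)
  finally show ?thesis by (simp add: exp_diff field_simps)
qed

text \<open>
  As \<open>L = ln ln n\<close> tends to infinity, the two sides tend to those of the preceding inequality.
\<close>
lemma eventually_coefficient_less:
  "eventually (\<lambda>L::real. (1 + 1 / L) * exp (1 + ln 4 / L + 1 / L)
     < exp euler_mascheroni * (\<Sum>k = 1..10. real (k\<^sup>2) powr (-(1 + 1 / L)))) at_top"
proof -
  have inv: "((\<lambda>L::real. c / L) \<longlongrightarrow> 0) at_top" for c :: real
    by (intro tendsto_divide_0[OF tendsto_const] filterlim_at_top_imp_at_infinity filterlim_ident)
  have "((\<lambda>L::real. exp euler_mascheroni * (\<Sum>k = 1..10. real (k\<^sup>2) powr (-(1 + 1 / L)))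
          - (1 + 1 / L) * exp (1 + ln 4 / L + 1 / L))
      \<longlongrightarrow> exp euler_mascheroni * (\<Sum>k = 1..10. real (k\<^sup>2) powr (-(1 + 0)))
          - (1 + 0) * exp (1 + 0 + 0)) at_top"
    by (intro tendsto_intros inv) auto
  moreover have "(\<Sum>k = 1..10. real (k\<^sup>2) powr (-(1 + 0))) = (\<Sum>k = 1..10::nat. 1 / real (k\<^sup>2))"
    by (intro sum.cong) (auto simp: powr_minus_divide)
  then have "exp euler_mascheroni * (\<Sum>k = 1..10::nat. real (k\<^sup>2) powr (-(1 + 0)))
      - (1 + 0) * exp (1 + 0 + 0 :: real) > 0"
    using exp_one_less_exp_euler_mascheroni_mult by (simp only: add_0_right mult_1 diff_gt_0_iff_gt)
  ultimately have "eventually (\<lambda>L::real. 0 < exp euler_mascheroni * (\<Sum>k = 1..10. real (k\<^sup>2) powr (-(1 + 1 / L)))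
          - (1 + 1 / L) * exp (1 + ln 4 / L + 1 / L)) at_top"
    by (rule order_tendstoD(1))
  then show ?thesis by (simp only: diff_gt_0_iff_gt)
qed

theorem mainTheorem5:
  shows "\<exists>A::real. A > 0 \<and>
    (\<forall>(n::nat) (m::nat) (q::nat \<Rightarrow> nat).
       m \<ge> 1 \<longrightarrow>
       (\<forall>i\<in>{1..m}. prime (q i)) \<longrightarrow>
       strict_mono_on {1..m} q \<longrightarrow>
       n = (\<Prod>i=1..m. q i) \<longrightarrow>
       real n \<ge> A \<longrightarrow>
       exp euler_mascheroni * real n * ln (ln (real n)) - real (divisor_sigma n) > 0)"
proof -
  let ?S = "\<lambda>L. \<Sum>k = 1..10. real (k\<^sup>2) powr (-(1 + 1 / L))"
  obtain L0 where L0: "\<And>L. L \<ge> L0 \<Longrightarrow>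
      (1 + 1 / L) * exp (1 + ln 4 / L + 1 / L) < exp euler_mascheroni * ?S L"
    using eventually_coefficient_less unfolding eventually_at_top_linorder by blast
  define A where "A = exp (exp (max 1 L0))"
  have "exp euler_mascheroni * real n * ln (ln (real n)) - real (divisor_sigma n) > 0"
    if q: "\<forall>i\<in>{1..m}. prime (q i)" "strict_mono_on {1..m} q"
      and n: "n = (\<Prod>i=1..m. q i)" and A: "real n \<ge> A"
    for n m :: nat and q :: "nat \<Rightarrow> nat"
  proof -
    define P where "P = q ` {1..m}"
    define L where "L = ln (ln (real n))"
    have nP: "n = \<Prod>P"
      unfolding P_def using n strict_mono_on_imp_inj_on[OF q(2)] by (simp add: prod.reindex)
    have pos: "real n > 0" using A unfolding A_def by (meson exp_gt_zero less_le_trans)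
    have ln: "ln (real n) \<ge> exp (max 1 L0)"
      using A pos unfolding A_def by (subst ln_ge_iff)
    then have "ln (real n) > 0" by (meson exp_gt_zero less_le_trans)
    then have L: "L \<ge> max 1 L0" using ln unfolding L_def by (subst ln_ge_iff)
    have "1 < exp (max 1 L0)" by (subst one_less_exp_iff) auto
    then have gt1: "ln (real n) > 1" using ln by (rule less_le_trans)
    have "?S L \<ge> real (1\<^sup>2) powr (-(1 + 1 / L))"
      by (rule member_le_sum[of "1::nat"]) auto
    then have S: "?S L > 0" by simp
    have "finite P" "\<And>p. p \<in> P \<Longrightarrow> prime p" using q(1) by (auto simp: P_def)
    from divisor_sigma_prod_primes_le_explicit[OF this, of 10]
    have "real (divisor_sigma n) * ?S L \<le> real n * L * ((1 + 1 / L) * exp (1 + ln 4 / L + 1 / L))"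
      unfolding nP[symmetric] L_def[symmetric] using gt1 by blast
    also have "\<dots> < real n * L * (exp euler_mascheroni * ?S L)"
      using L0[of L] L pos by (intro mult_strict_left_mono mult_pos_pos) auto
    finally have "real (divisor_sigma n) * ?S L < (exp euler_mascheroni * real n * L) * ?S L"
      by (simp only: mult_ac)
    then have "real (divisor_sigma n) < exp euler_mascheroni * real n * L"
      using S by (simp add: mult_less_cancel_right)
    then show ?thesis by (simp add: L_def)
  qed
  then show ?thesis by (intro exI[of _ A]) (auto simp: A_def)
qed

end
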